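(* Let $f_1:[a,b]\to\mathbb{R}$ ($a<b$) be an increasing polynomial of degree $m\ge 1$, and let $B_n^{f_1}$ be the generalized Bernstein operator over $[a,b]$ fixing $f_1$ and the constant function $\mathbf{1}$ (which exists for all sufficiently large $n$). Denote by $B_n$ the classical Bernstein operator over $[a,b]$, and denote by $s-1\ge 0$ the largest order of the zeros of $f_1'$ in $[a,b]$ (with $s-1=0$ if $f_1'$ has no zeros in $[a,b]$). Then there exist a constant $K=K(f_1|_{[a,b]})>0$ and a natural number $n_0$ such that for all $f\in C[a,b]$, all $x\in[a,b]$ and all $n\ge n_0$, $$\left|B_n^{f_1}f(x)-B_nf(x)\right|\le\omega\left(f,Kn^{-1/s}\right).$$
   Context: $\mathbb{P}_n[a,b]$ is the space of real polynomials of degree at most $n$ on $[a,b]$, with the standard Bernstein basis $p_{n,k}(x)=\binom{n}{k}\frac{(x-a)^k(b-x)^{n-k}}{(b-a)^n}$, $k=0,\dots,n$. The classical Bernstein operator is $B_nf=\sum_{k=0}^n f\left(a+\frac{k}{n}(b-a)\right)p_{n,k}$. A generalized Bernstein operator $C[a,b]\to\mathbb{P}_n[a,b]$ is an operator of the form $f\mapsto\sum_{k=0}^n f(t_{n,k})\,\alpha_{n,k}\,p_{n,k}$ with nodes $t_{n,k}\in[a,b]$ and weights $\alpha_{n,k}>0$. For $f_1\in\mathbb{P}_n[a,b]$ strictly increasing on $[a,b]$ (a non-constant increasing polynomial is strictly increasing), $f_1=\sum_{k=0}^n\gamma_{n,k}p_{n,k}$, the operator $B_n^{f_1}$ is the unique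 (if it exists) generalized Bernstein operator fixing (i.e. mapping to themselves) $\mathbf{1}$ and $f_1$; it has weights $\alpha_{n,k}=1$ and nodes $t_{n,k}=f_1^{-1}(\gamma_{n,k})$, and it exists exactly when all $\gamma_{n,k}\in[f_1(a),f_1(b)]$. The modulus of continuity of $f\in C[a,b]$ is $\omega(f,\delta)=\sup\{|f(x)-f(y)|:x,y\in[a,b],\ |x-y|\le\delta\}$. *)

theory Defs
  imports "HOL-Analysis.Analysis" "HOL-Computational_Algebra.Polynomial"
begin

definition bernstein_basis :: "real \<Rightarrow> real \<Rightarrow> nat \<Rightarrow> nat \<Rightarrow> real \<Rightarrow> real" where
  "bernstein_basis a b n k x =
     real (n choose k) * ((x - a) ^ k * (b - x) ^ (n - k)) / (b - a) ^ n"

definition bernstein_op :: "real \<Rightarrow> real \<Rightarrow> nat \<Rightarrow> (real \<Rightarrow> real) \<Rightarrow> real \<Rightarrow> real" where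
  "bernstein_op a b n f x =
     (\<Sum>k\<le>n. f (a + real k / real n * (b - a)) * bernstein_basis a b n k x)"

(* An operator on C[a,b] is represented by a map on total functions; only its action on
   functions continuous on {a..b}, evaluated at points of {a..b}, is constrained. *)
definition generalized_bernstein_op ::
    "real \<Rightarrow> real \<Rightarrow> nat \<Rightarrow> ((real \<Rightarrow> real) \<Rightarrow> real \<Rightarrow> real) \<Rightarrow> bool" where
  "generalized_bernstein_op a b n T \<longleftrightarrow>
     (\<exists>(t :: nat \<Rightarrow> real) (\<alpha> :: nat \<Rightarrow> real).
        (\<forall>k\<le>n. t k \<in> {a..b} \<and> \<alpha> k > 0) \<and>
        (\<forall>f. continuous_on {a..b} f \<longrightarrow>
           (\<forall>x\<in>{a..b}. T f x = (\<Sum>k\<le>n. f (t k) * \<alpha> k * bernstein_basis a b n k x))))"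

definition fixes_on :: "real \<Rightarrow> real \<Rightarrow> ((real \<Rightarrow> real) \<Rightarrow> real \<Rightarrow> real) \<Rightarrow> (real \<Rightarrow> real) \<Rightarrow> bool" where
  "fixes_on a b T g \<longleftrightarrow> (\<forall>x\<in>{a..b}. T g x = g x)"

(* T is B_n^{f1}.  For a < b and f1 strictly increasing on {a..b}, at most one operator on
   C[a,b] has this property, so it is used as a predicate rather than through a choice operator. *)
definition is_bernstein_fixing ::
    "real \<Rightarrow> real \<Rightarrow> (real \<Rightarrow> real) \<Rightarrow> nat \<Rightarrow> ((real \<Rightarrow> real) \<Rightarrow> real \<Rightarrow> real) \<Rightarrow> bool" where
  "is_bernstein_fixing a b f1 n T \<longleftrightarrow>
     generalized_bernstein_op a b n T \<and> fixes_on a b T (\<lambda>_. 1) \<and> fixes_on a b T f1"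

definition modulus_of_continuity :: "real \<Rightarrow> real \<Rightarrow> (real \<Rightarrow> real) \<Rightarrow> real \<Rightarrow> real" where
  "modulus_of_continuity a b f \<delta> =
     Sup {\<bar>f x - f y\<bar> | x y. x \<in> {a..b} \<and> y \<in> {a..b} \<and> \<bar>x - y\<bar> \<le> \<delta>}"

(* Intended for q \<noteq> 0, so that the set of zeros is finite; inserting 0 gives the value 0 when
   there are no zeros in {a..b}. *)
definition max_zero_order :: "real \<Rightarrow> real \<Rightarrow> real poly \<Rightarrow> nat" where
  "max_zero_order a b q = Max (insert 0 ((\<lambda>z. order z q) ` {z \<in> {a..b}. poly q z = 0}))"

end

theory Submission
  imports Defs
begin

text \<open>
  Transport \<open>f1\<close> to \<open>[0,1]\<close> and let \<open>\<gamma>\<^sub>k\<close> be the coefficients of the resulting polynomial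
  \<open>g\<close> in the Bernstein basis of degree \<open>n\<close>. Since the Bernstein basis is linearly independent, an
  operator fixing \<open>1\<close> and \<open>f1\<close> has weights 1 and nodes \<open>t\<^sub>k\<close> with \<open>f1 t\<^sub>k = \<gamma>\<^sub>k\<close>. Since the
  basis is also nonnegative with sum 1, the difference of the two operators is at most \<open>\<omega>(f, \<delta>)\<close>
  as soon as every \<open>t\<^sub>k\<close> lies within \<open>\<delta>\<close> of the classical node \<open>r\<^sub>k = a + (k/n) (b - a)\<close>.

  Two estimates bound this distance. The coefficient \<open>(k choose i) / (n choose i)\<close> of a monomial
  differs from \<open>(k/n)\<^sup>i\<close> by \<open>O(1/n)\<close>, so \<open>\<bar>f1 t\<^sub>k - f1 r\<^sub>k\<bar> \<le> C/n\<close>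
  (\<open>bernstein_coeff_approx_value\<close>). On the other hand, \<open>f1 y - f1 x \<ge> c (y - x)\<^sup>s\<close> for
  \<open>a \<le> x \<le> y \<le> b\<close> and some \<open>c > 0\<close> (\<open>mono_poly_increment_lower_bound\<close>). Together they give
  \<open>\<bar>t\<^sub>k - r\<^sub>k\<bar> \<le> (C/(c n)) powr (1/s)\<close>.

  The operator exists once all \<open>\<gamma>\<^sub>k\<close> lie between \<open>f1 a\<close> and \<open>f1 b\<close>. For the lower bound,
  \<open>g(u) - g(0) = u\<^sup>j h(u)\<close> with \<open>h > 0\<close> on \<open>[0,1]\<close>. For large degree the Bernstein coefficients
  of \<open>h\<close> are close to values of \<open>h\<close>, hence positive, and the factor \<open>u\<^sup>j\<close> preserves
  nonnegativity. The upper bound follows by the reflection \<open>u \<mapsto> 1 - u\<close>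
  (\<open>eventually_bernstein_coeff_in_range\<close>).
\<close>

section \<open>Growth of an increasing polynomial\<close>

text \<open>The coefficients of a polynomial of degree at most \<open>m\<close> are controlled by the maximum of
  its modulus on \<open>[0,1]\<close>. The combination \<open>p(u) - 2\<^sup>m p(u/2)\<close> has no term of degree \<open>m\<close> and multiplies
  every other coefficient by a factor of modulus at least 1, which makes an induction work.\<close>
lemma coeffs_bounded_by_max_on_unit_interval:
  "\<exists>C\<ge>0. \<forall>(c::nat \<Rightarrow> real) M. (\<forall>u\<in>{0..1}. \<bar>\<Sum>j\<le>m. c j * u ^ j\<bar> \<le> M) \<longrightarrow> (\<forall>j\<le>m. \<bar>c j\<bar> \<le> C * M)"
proof (induction m)
  case 0
  show ?case by (intro exI[of _ 1]) auto
next
  case (Suc m)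
  then obtain C where C: "C \<ge> 0" and
    IH: "\<And>(c::nat \<Rightarrow> real) M j. (\<forall>u\<in>{0..1}. \<bar>\<Sum>j\<le>m. c j * u ^ j\<bar> \<le> M) \<Longrightarrow> j \<le> m \<Longrightarrow> \<bar>c j\<bar> \<le> C * M"
    by blast
  define C' where "C' = C * (1 + 2 ^ Suc m)"
  have C': "C' \<ge> 0" using C by (simp add: C'_def)
  define C'' where "C'' = 1 + (real m + 2) * C'"
  have "\<bar>c j\<bar> \<le> C'' * M"
    if M: "\<forall>u\<in>{0..1}. \<bar>\<Sum>j\<le>Suc m. c j * u ^ j\<bar> \<le> M" and j: "j \<le> Suc m" for c :: "nat \<Rightarrow> real" and M j
  proof -
    have "\<bar>\<Sum>j\<le>Suc m. c j * 0 ^ j\<bar> \<le> M" using M by force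
    then have M0: "M \<ge> 0" by linarith
    have low: "\<bar>c i\<bar> \<le> C' * M" if i: "i \<le> m" for i
    proof -
      define d where "d i = c i * (1 - 2 ^ (Suc m - i))" for i
      have "\<bar>\<Sum>j\<le>m. d j * u ^ j\<bar> \<le> (1 + 2 ^ Suc m) * M" if u: "u \<in> {0..1}" for u
      proof -
        have "(\<Sum>j\<le>m. d j * u ^ j) = (\<Sum>j\<le>Suc m. d j * u ^ j)" by (simp add: d_def)
        also have "\<dots> = (\<Sum>j\<le>Suc m. c j * u ^ j) - 2 ^ Suc m * (\<Sum>j\<le>Suc m. c j * (u/2) ^ j)"
          unfolding sum_distrib_left sum_subtractf[symmetric]
          by (intro sum.cong) (auto simp: d_def power_diff power_divide field_simps)
        also have "\<bar>\<dots>\<bar> \<le> \<bar>\<Sum>j\<le>Suc m. c j * u ^ j\<bar> + 2 ^ Suc m * \<bar>\<Sum>j\<le>Suc m. c j * (u/2) ^ j\<bar>"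
          using abs_triangle_ineq4[of "\<Sum>j\<le>Suc m. c j * u ^ j" "2 ^ Suc m * (\<Sum>j\<le>Suc m. c j * (u/2) ^ j)"]
          by (simp only: abs_mult power_abs abs_numeral)
        also have "\<dots> \<le> M + 2 ^ Suc m * M"
          using u by (intro add_mono mult_left_mono M[rule_format]) auto
        finally show ?thesis by (simp add: algebra_simps)
      qed
      then have "\<bar>d i\<bar> \<le> C' * M"
        using IH[of d "(1 + 2 ^ Suc m) * M" i] i by (simp add: C'_def mult.assoc)
      moreover have "\<bar>c i\<bar> \<le> \<bar>d i\<bar>"
      proof -
        have "(2::real) ^ 1 \<le> 2 ^ (Suc m - i)" using i by (intro power_increasing) auto
        then have "\<bar>c i\<bar> * 1 \<le> \<bar>c i\<bar> * \<bar>1 - 2 ^ (Suc m - i)\<bar>" by (intro mult_left_mono) auto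
        then show ?thesis by (simp add: d_def abs_mult)
      qed
      ultimately show ?thesis by linarith
    qed
    have CM: "C' * M \<ge> 0" using C' M0 by simp
    have expand: "C'' * M = M + (real m + 2) * (C' * M)" by (simp add: C''_def algebra_simps)
    show ?thesis
    proof (cases "j \<le> m")
      case True
      have "1 * (C' * M) \<le> (real m + 2) * (C' * M)" by (intro mult_right_mono CM) auto
      then show ?thesis using low[OF True] M0 expand by linarith
    next
      case False
      then have [simp]: "j = Suc m" using j by simp
      have M1: "\<bar>\<Sum>j\<le>Suc m. c j * 1 ^ j\<bar> \<le> M" by (rule M[rule_format]) simp
      have "c j = (\<Sum>j\<le>Suc m. c j * 1 ^ j) - (\<Sum>j\<le>m. c j)" by simp
      also have "\<bar>\<dots>\<bar> \<le> M + (\<Sum>j\<le>m. \<bar>c j\<bar>)"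
        using M1 sum_abs[of c "{..m}"] by linarith
      also have "(\<Sum>j\<le>m. \<bar>c j\<bar>) \<le> (\<Sum>j\<le>m. C' * M)" by (intro sum_mono low) auto
      also have "\<dots> = (real m + 1) * (C' * M)" by simp
      also have "\<dots> \<le> (real m + 2) * (C' * M)" by (intro mult_right_mono CM) auto
      finally show ?thesis using expand by simp
    qed
  qed
  moreover have "C'' \<ge> 0" using C' by (simp add: C''_def)
  ultimately show ?case by blast
qed

lemma continuous_on_coeff_pcompose_shift:
  fixes p :: "real poly"
  shows "continuous_on A (\<lambda>x. coeff (pcompose p [:x, 1:]) j)"
proof (induction p arbitrary: j)
  case 0
  show ?case by simp
next
  case (pCons a p)
  have "coeff (pcompose (pCons a p) [:x, 1:]) j =
      coeff [:a:] j + (x * coeff (pcompose p [:x, 1:]) j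
        + (case j of 0 \<Rightarrow> 0 | Suc i \<Rightarrow> coeff (pcompose p [:x, 1:]) i))" for x
    by (simp add: pcompose_pCons coeff_pCons split: nat.split)
  then show ?case
    using pCons.IH by (cases j) (auto intro!: continuous_intros)
qed

text \<open>If the Taylor coefficients of \<open>p\<close> at \<open>z\<close> of orders \<open>1, \<dots>, s\<close> all vanish, then the
  derivative of \<open>p\<close> has a zero of order at least \<open>s\<close> at \<open>z\<close>.\<close>
lemma order_pderiv_ge_if_taylor_coeffs_zero:
  fixes p :: "real poly"
  assumes "\<And>j. 1 \<le> j \<Longrightarrow> j \<le> s \<Longrightarrow> coeff (pcompose p [:z, 1:]) j = 0"
    and "pderiv p \<noteq> 0"
  shows "s \<le> order z (pderiv p)"
proof -
  define q where "q = pcompose p [:z, 1:] - [:poly p z:]"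
  have "coeff q k = 0" if "k < Suc s" for k
    using assms(1)[of k] that by (cases k) (auto simp: q_def pcompose_coeff_0)
  then obtain r where r: "q = monom 1 (Suc s) * r"
    using monom_1_dvd_iff'[of "Suc s" q] by (auto elim!: dvdE)
  have inv: "pcompose [:z, 1:] [:-z, 1:] = [:0, 1:]" by (simp add: pcompose_pCons)
  have "pcompose q [:-z, 1:] = p - [:poly p z:]"
    by (simp add: q_def pcompose_diff pcompose_assoc[symmetric] inv)
  moreover have "pcompose (monom 1 (Suc s)) [:-z, 1:] = [:-z, 1:] ^ Suc s"
    by (simp add: poly_eq_poly_eq_iff[symmetric] fun_eq_iff poly_pcompose poly_monom del: power_Suc)
  ultimately have "p - [:poly p z:] = [:-z, 1:] ^ Suc s * pcompose r [:-z, 1:]"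
    by (simp add: r pcompose_mult del: power_Suc)
  then have "pderiv (p - [:poly p z:]) = pderiv ([:-z, 1:] ^ Suc s * pcompose r [:-z, 1:])"
    by simp
  moreover have "[:-z, 1:] ^ s dvd pderiv ([:-z, 1:] ^ Suc s * t)" for t
    unfolding pderiv_mult pderiv_power_Suc
    by (intro dvd_add dvd_mult2[OF le_imp_power_dvd] dvd_mult dvd_mult2[OF dvd_smult]) auto
  ultimately have "[:-z, 1:] ^ s dvd pderiv p"
    by (simp add: pderiv_diff del: power_Suc)
  then show ?thesis using assms(2) by (simp add: order_divides)
qed

text \<open>At every point of \<open>[a, b]\<close> one of the Taylor coefficients of orders \<open>1, \<dots>, s\<close> is nonzero,
  so by compactness the sum of their absolute values is bounded below. On \<open>[x, y]\<close> the
  increment of \<open>p\<close> from \<open>x\<close> is largest at \<open>y\<close>, so \<open>p y - p x\<close> dominates, up to a constant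
  that depends only on the degree, the modulus of each Taylor term \<open>A\<^sub>j (y - x)\<^sup>j\<close> with \<open>j \<ge> 1\<close>.\<close>
lemma mono_poly_increment_lower_bound:
  fixes p :: "real poly"
  assumes ab: "a < b"
    and mono: "mono_on {a..b} (poly p)"
    and nz: "pderiv p \<noteq> 0"
    and ord: "\<And>z. z \<in> {a..b} \<Longrightarrow> order z (pderiv p) < s"
  obtains c where "c > 0"
    "\<And>x y. a \<le> x \<Longrightarrow> x \<le> y \<Longrightarrow> y \<le> b \<Longrightarrow> c * (y - x) ^ s \<le> poly p y - poly p x"
proof -
  define m where "m = degree p"
  define A where "A x j = coeff (pcompose p [:x, 1:]) j" for x j
  have degA: "A x j = 0" if "j > m" for x j
    using that unfolding A_def m_def by (intro coeff_eq_0) (simp add: degree_pcompose)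
  have cont: "continuous_on {a..b} (\<lambda>x. \<Sum>j=1..s. \<bar>A x j\<bar>)"
    unfolding A_def by (intro continuous_intros continuous_on_coeff_pcompose_shift)
  have "{a..b} \<noteq> {}" using ab by simp
  then obtain z where z: "z \<in> {a..b}"
    and zmin: "\<And>x. x \<in> {a..b} \<Longrightarrow> (\<Sum>j=1..s. \<bar>A z j\<bar>) \<le> (\<Sum>j=1..s. \<bar>A x j\<bar>)"
    using continuous_attains_inf[OF compact_Icc _ cont] by blast
  define \<mu> where "\<mu> = (\<Sum>j=1..s. \<bar>A z j\<bar>)"
  have "\<mu> \<noteq> 0"
  proof
    assume "\<mu> = 0"
    then have "\<forall>j\<in>{1..s}. \<bar>A z j\<bar> = 0" unfolding \<mu>_def by (subst (asm) sum_nonneg_eq_0_iff) auto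
    then have "s \<le> order z (pderiv p)"
      by (intro order_pderiv_ge_if_taylor_coeffs_zero nz) (auto simp: A_def)
    then show False using ord[OF z] by simp
  qed
  moreover have "\<mu> \<ge> 0" unfolding \<mu>_def by (intro sum_nonneg) auto
  ultimately have \<mu>: "\<mu> > 0" by simp
  obtain C where C: "C \<ge> 0" and
    bound: "\<And>(c::nat \<Rightarrow> real) M j. (\<forall>u\<in>{0..1}. \<bar>\<Sum>j\<le>m. c j * u ^ j\<bar> \<le> M) \<Longrightarrow> j \<le> m \<Longrightarrow> \<bar>c j\<bar> \<le> C * M"
    using coeffs_bounded_by_max_on_unit_interval[of m] by blast
  \<comment> \<open>The factor \<open>max 1 (b - a) ^ s\<close> allows comparing \<open>L ^ s\<close> with \<open>L ^ j\<close> for \<open>j \<le> s\<close>; adding 1 keeps \<open>E\<close> positive.\<close>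
  define E where "E = real s * (max 1 (b - a)) ^ s * C + 1"
  have E: "E > 0" using C by (simp add: E_def add_nonneg_pos)
  have "\<mu> / E * (y - x) ^ s \<le> poly p y - poly p x" if xy: "a \<le> x" "x \<le> y" "y \<le> b" for x y
  proof -
    define L where "L = y - x"
    define \<Delta> where "\<Delta> = poly p y - poly p x"
    have L: "0 \<le> L" "L \<le> b - a" using xy by (auto simp: L_def)
    have \<Delta>: "0 \<le> \<Delta>" using mono_onD[OF mono, of x y] xy by (simp add: \<Delta>_def)
    have incr: "\<bar>\<Sum>j\<le>m. (if j = 0 then 0 else A x j * L ^ j) * u ^ j\<bar> \<le> \<Delta>" if u: "u \<in> {0..1}" for u
    proof -
      have "poly p (x + L * u) = poly (pcompose p [:x, 1:]) (L * u)" by (simp add: poly_pcompose)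
      also have "\<dots> = (\<Sum>j\<le>m. A x j * (L * u) ^ j)"
        by (simp add: poly_altdef degree_pcompose A_def m_def)
      also have "\<dots> = (\<Sum>j\<le>m. (if j = 0 then A x 0 else 0)
            + (if j = 0 then 0 else A x j * L ^ j) * u ^ j)"
        by (intro sum.cong) (auto simp: power_mult_distrib)
      also have "\<dots> = poly p x + (\<Sum>j\<le>m. (if j = 0 then 0 else A x j * L ^ j) * u ^ j)"
        by (simp add: sum.distrib A_def pcompose_coeff_0)
      finally have eq: "(\<Sum>j\<le>m. (if j = 0 then 0 else A x j * L ^ j) * u ^ j)
          = poly p (x + L * u) - poly p x" by simp
      have "0 \<le> L * u" "L * u \<le> L" using L u by (auto simp: mult_left_le)
      then have "poly p x \<le> poly p (x + L * u)" "poly p (x + L * u) \<le> poly p y"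
        using xy by (auto intro!: mono_onD[OF mono] simp: L_def)
      then show ?thesis unfolding eq \<Delta>_def by simp
    qed
    have term_le: "\<bar>A x j\<bar> * L ^ j \<le> C * \<Delta>" if "1 \<le> j" for j
    proof (cases "j \<le> m")
      case True
      then show ?thesis using bound[of "\<lambda>j. if j = 0 then 0 else A x j * L ^ j" \<Delta> j] incr that L
        by (simp add: abs_mult)
    next
      case False
      then show ?thesis using degA C \<Delta> by simp
    qed
    have "\<mu> * L ^ s \<le> (\<Sum>j=1..s. \<bar>A x j\<bar>) * L ^ s"
      using zmin[of x] xy L by (intro mult_right_mono) (auto simp: \<mu>_def)
    also have "\<dots> = (\<Sum>j=1..s. \<bar>A x j\<bar> * L ^ s)" by (rule sum_distrib_right)
    also have "\<dots> \<le> (\<Sum>j=1..s. C * \<Delta> * (max 1 (b - a)) ^ s)"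
    proof (rule sum_mono)
      fix j assume j: "j \<in> {1..s}"
      then have "L ^ s = L ^ j * L ^ (s - j)" by (simp flip: power_add)
      then have "\<bar>A x j\<bar> * L ^ s = \<bar>A x j\<bar> * L ^ j * L ^ (s - j)" by simp
      also have "\<dots> \<le> C * \<Delta> * (max 1 (b - a)) ^ s"
      proof (rule mult_mono)
        have "L ^ (s - j) \<le> (max 1 (b - a)) ^ (s - j)" using L by (intro power_mono) auto
        also have "\<dots> \<le> (max 1 (b - a)) ^ s" by (intro power_increasing) auto
        finally show "L ^ (s - j) \<le> (max 1 (b - a)) ^ s" .
      qed (use term_le j C \<Delta> L in auto)
      finally show "\<bar>A x j\<bar> * L ^ s \<le> C * \<Delta> * (max 1 (b - a)) ^ s" .
    qed
    also have "\<dots> \<le> E * \<Delta>" using \<Delta> by (simp add: E_def algebra_simps)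
    finally show ?thesis using E by (simp add: L_def \<Delta>_def field_simps)
  qed
  moreover have "\<mu> / E > 0" using \<mu> E by simp
  ultimately show ?thesis using that by blast
qed

section \<open>Bernstein coefficients\<close>

text \<open>The coefficients of \<open>p\<close> in the Bernstein basis of degree \<open>n\<close> on \<open>[0,1]\<close>, valid for
  \<open>n \<ge> degree p\<close>: the monomial \<open>u\<^sup>i\<close> has the coefficients \<open>(k choose i) / (n choose i)\<close>.\<close>
definition bernstein_coeff :: "real poly \<Rightarrow> nat \<Rightarrow> nat \<Rightarrow> real" where
  "bernstein_coeff p n k = (\<Sum>i\<le>degree p. coeff p i * (real (k choose i) / real (n choose i)))"

lemma bernstein_coeff_eq_sum:
  assumes "degree p \<le> N"
  shows "bernstein_coeff p n k = (\<Sum>i\<le>N. coeff p i * (real (k choose i) / real (n choose i)))"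
  unfolding bernstein_coeff_def
  by (rule sum.mono_neutral_left) (use assms in \<open>auto simp: coeff_eq_0\<close>)

lemma bernstein_coeff_const [simp]: "bernstein_coeff [:c:] n k = c"
  by (simp add: bernstein_coeff_def)

lemma bernstein_coeff_diff:
  "bernstein_coeff (p - q) n k = bernstein_coeff p n k - bernstein_coeff q n k"
proof -
  define N where "N = max (degree p) (degree q)"
  have "bernstein_coeff r n k = (\<Sum>i\<le>N. coeff r i * (real (k choose i) / real (n choose i)))"
    if "r \<in> {p, q, p - q}" for r
    using that by (intro bernstein_coeff_eq_sum) (auto simp: N_def degree_diff_le_max)
  then show ?thesis
    by (simp only: insert_iff simp_thms coeff_diff left_diff_distrib sum_subtractf)
qed

section \<open>Expansion and uniqueness\<close>

lemma power_eq_sum_Bernstein: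
  assumes "i \<le> n"
  shows "u ^ i = (\<Sum>k\<le>n. real (k choose i) / real (n choose i) * Bernstein n k u)"
proof -
  have eq: "real (k + i choose i) / real (n choose i) * Bernstein n (k + i) u = u ^ i * Bernstein (n - i) k u"
    if "k \<le> n - i" for k
  proof -
    have "(n choose (k + i)) * (k + i choose i) = (n choose i) * ((n - i) choose k)"
      using choose_mult[of i "k + i" n] that assms by simp
    then have "real (k + i choose i) * real (n choose (k + i)) = real ((n - i) choose k) * real (n choose i)"
      unfolding of_nat_mult[symmetric] by (simp add: mult.commute)
    moreover have "real (n choose i) \<noteq> 0" using assms by simp
    ultimately have "real (k + i choose i) / real (n choose i) * real (n choose (k + i)) = real ((n - i) choose k)"
      by (simp add: field_simps)
    then have "real (k + i choose i) / real (n choose i) * real (n choose (k + i))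
        * (u ^ (k + i) * (1 - u) ^ (n - (k + i))) =
        real ((n - i) choose k) * (u ^ (k + i) * (1 - u) ^ (n - (k + i)))"
      by simp
    then show ?thesis by (simp add: Bernstein_def power_add mult_ac add_ac)
  qed
  have "(\<Sum>k\<le>n. real (k choose i) / real (n choose i) * Bernstein n k u)
      = (\<Sum>k\<in>{i..n}. real (k choose i) / real (n choose i) * Bernstein n k u)"
    by (rule sum.mono_neutral_right) (auto simp: not_le)
  also have "\<dots> = (\<Sum>k\<le>n - i. real (k + i choose i) / real (n choose i) * Bernstein n (k + i) u)"
    by (rule sum.reindex_bij_witness[of _ "\<lambda>k. k + i" "\<lambda>k. k - i"]) (use assms in auto)
  also have "\<dots> = (\<Sum>k\<le>n - i. u ^ i * Bernstein (n - i) k u)"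
    by (rule sum.cong) (use eq in auto)
  also have "\<dots> = u ^ i" by (simp flip: sum_distrib_left)
  finally show ?thesis by simp
qed

lemma poly_eq_sum_bernstein_coeff:
  assumes "degree p \<le> n"
  shows "poly p u = (\<Sum>k\<le>n. bernstein_coeff p n k * Bernstein n k u)"
proof -
  have "poly p u = (\<Sum>i\<le>degree p. coeff p i * (\<Sum>k\<le>n. real (k choose i) / real (n choose i) * Bernstein n k u))"
    unfolding poly_altdef
    by (intro sum.cong refl, subst power_eq_sum_Bernstein[of _ n]) (use assms in auto)
  also have "\<dots> = (\<Sum>i\<le>degree p. \<Sum>k\<le>n. coeff p i * (real (k choose i) / real (n choose i)) * Bernstein n k u)"
    by (simp add: sum_distrib_left mult.assoc)
  also have "\<dots> = (\<Sum>k\<le>n. bernstein_coeff p n k * Bernstein n k u)"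
    unfolding bernstein_coeff_def sum_distrib_right by (rule sum.swap)
  finally show ?thesis .
qed

text \<open>The substitution \<open>u = v / (1 + v)\<close> turns the Bernstein basis into a multiple of the
  monomials, up to the common factor \<open>(1 + v)\<^sup>n\<close>.\<close>
lemma Bernstein_linear_independent:
  assumes "\<And>u. 0 < u \<Longrightarrow> u < 1 \<Longrightarrow> (\<Sum>k\<le>n. d k * Bernstein n k u) = 0" and "k \<le> n"
  shows "d k = 0"
proof -
  define P where "P = (\<Sum>k\<le>n. monom (d k * real (n choose k)) k)"
  have "poly P v = 0" if v: "v > 0" for v
  proof -
    have u: "0 < v / (1 + v)" "v / (1 + v) < 1" "1 - v / (1 + v) = 1 / (1 + v)"
      using v by (auto simp: field_simps)
    have "poly P v = (1 + v) ^ n * (\<Sum>k\<le>n. d k * Bernstein n k (v / (1 + v)))"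
      unfolding P_def poly_sum sum_distrib_left
    proof (rule sum.cong)
      fix k assume "k \<in> {..n}"
      then have "(1 + v) ^ n = (1 + v) ^ k * (1 + v) ^ (n - k)" by (simp flip: power_add)
      then show "poly (monom (d k * real (n choose k)) k) v = (1 + v) ^ n * (d k * Bernstein n k (v / (1 + v)))"
        unfolding Bernstein_def u(3) using v by (simp add: poly_monom power_divide)
    qed simp
    then show ?thesis using assms(1)[OF u(1,2)] by simp
  qed
  then have "{0<..} \<subseteq> {v. poly P v = 0}" by auto
  then have "infinite {v. poly P v = 0}" using infinite_Ioi infinite_super by blast
  then have "P = 0" using poly_roots_finite by blast
  moreover have "coeff P k = d k * real (n choose k)"
    using assms(2) by (simp add: P_def coeff_sum)
  ultimately show ?thesis using assms(2) by simp
qed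

lemma bernstein_coeff_reflect:
  assumes p: "degree p \<le> n" and k: "k \<le> n"
  shows "bernstein_coeff (pcompose p [:1, -1:]) n k = bernstein_coeff p n (n - k)"
proof -
  have "(\<Sum>k\<le>n. (bernstein_coeff (pcompose p [:1, -1:]) n k - bernstein_coeff p n (n - k)) * Bernstein n k u) = 0"
    for u
  proof -
    have "(\<Sum>k\<le>n. bernstein_coeff (pcompose p [:1, -1:]) n k * Bernstein n k u) = poly p (1 - u)"
      using poly_eq_sum_bernstein_coeff[of "pcompose p [:1, -1:]" n u] p
      by (simp add: degree_pcompose poly_pcompose)
    also have "\<dots> = (\<Sum>k\<le>n. bernstein_coeff p n k * Bernstein n k (1 - u))"
      by (rule poly_eq_sum_bernstein_coeff[OF p])
    also have "\<dots> = (\<Sum>k\<le>n. bernstein_coeff p n (n - k) * Bernstein n k u)"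
      by (rule sum.reindex_bij_witness[of _ "\<lambda>k. n - k" "\<lambda>k. n - k"])
        (auto simp: Bernstein_def binomial_symmetric[symmetric])
    finally show ?thesis by (simp add: left_diff_distrib sum_subtractf)
  qed
  then have "bernstein_coeff (pcompose p [:1, -1:]) n k - bernstein_coeff p n (n - k) = 0"
    using Bernstein_linear_independent[where d = "\<lambda>k. bernstein_coeff (pcompose p [:1, -1:]) n k - bernstein_coeff p n (n - k)"] k
    by blast
  then show ?thesis by simp
qed

section \<open>Comparison with the values at \<open>k / n\<close>\<close>

lemma binomial_ratio_approx_power:
  assumes "k \<le> n" "i \<le> n" "n > 0"
  shows "\<bar>real (k choose i) / real (n choose i) - (real k / real n) ^ i\<bar> \<le> real i ^ 2 / real n"
  using assms(2)
proof (induction i)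
  case 0
  show ?case by simp
next
  case (Suc i)
  define r where "r = real (k choose i) / real (n choose i)"
  define w where "w = real k / real n"
  define q where "q = real (k - i) / real (n - i)"
  have step: "real (Suc i) * real (m choose Suc i) = real (m - i) * real (m choose i)" for m
    unfolding of_nat_mult[symmetric] by (simp only: binomial_absorption binomial_absorb_comp)
  have "real (m choose Suc i) = real (m - i) * real (m choose i) / real (Suc i)" for m
    using step[of m] by (simp add: field_simps del: of_nat_Suc)
  then have rq: "real (k choose Suc i) / real (n choose Suc i) = r * q"
    by (simp add: r_def q_def mult.commute del: of_nat_Suc)
  have w: "0 \<le> w" "w \<le> 1" using assms by (auto simp: w_def)
  have q: "0 \<le> q" "q \<le> 1" using assms by (auto simp: q_def divide_le_eq_1)
  have IH: "\<bar>r - w ^ i\<bar> \<le> real i ^ 2 / real n" using Suc by (simp add: r_def w_def)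
  have qw: "\<bar>q - w\<bar> \<le> real i / real n"
  proof (cases "i \<le> k")
    case True
    have "real (k - i) / real n \<le> q"
      unfolding q_def using Suc.prems by (intro divide_left_mono) auto
    moreover have "real (k - i) / real n = w - real i / real n"
      using True by (simp add: w_def of_nat_diff diff_divide_distrib)
    moreover have "q \<le> w"
    proof -
      have "real k * real i \<le> real n * real i" using assms by (intro mult_right_mono) auto
      then have "(real k - real i) * real n \<le> real k * (real n - real i)" by (simp add: algebra_simps)
      then show ?thesis
        unfolding q_def w_def using True Suc.prems assms(3) by (simp add: field_simps of_nat_diff)
    qed
    ultimately show ?thesis by linarith
  next
    case False
    then show ?thesis using w by (simp add: q_def w_def divide_right_mono)
  qed
  have "r * q - w ^ Suc i = (r - w ^ i) * q + w ^ i * (q - w)" by (simp add: algebra_simps)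
  also have "\<bar>\<dots>\<bar> \<le> \<bar>r - w ^ i\<bar> * q + w ^ i * \<bar>q - w\<bar>"
    using abs_triangle_ineq[of "(r - w ^ i) * q" "w ^ i * (q - w)"] q w by (simp add: abs_mult)
  also have "\<dots> \<le> \<bar>r - w ^ i\<bar> * 1 + 1 * \<bar>q - w\<bar>"
    using q w by (intro add_mono mult_left_mono mult_right_mono power_le_one) auto
  also have "\<dots> \<le> real i ^ 2 / real n + real i / real n" using IH qw by simp
  also have "\<dots> = (real i ^ 2 + real i) / real n" by (rule add_divide_distrib[symmetric])
  also have "\<dots> \<le> real (Suc i) ^ 2 / real n"
    by (intro divide_right_mono) (auto simp: power2_eq_square algebra_simps)
  finally show ?case by (simp add: rq w_def)
qed

lemma bernstein_coeff_approx_value: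
  obtains C where "C \<ge> 0"
    "\<And>n k. degree p \<le> n \<Longrightarrow> n > 0 \<Longrightarrow> k \<le> n \<Longrightarrow>
       \<bar>bernstein_coeff p n k - poly p (real k / real n)\<bar> \<le> C / real n"
proof -
  define C where "C = (\<Sum>i\<le>degree p. \<bar>coeff p i\<bar> * real i ^ 2)"
  have "\<bar>bernstein_coeff p n k - poly p (real k / real n)\<bar> \<le> C / real n"
    if n: "degree p \<le> n" "n > 0" and k: "k \<le> n" for n k
  proof -
    have "bernstein_coeff p n k - poly p (real k / real n) =
        (\<Sum>i\<le>degree p. coeff p i * (real (k choose i) / real (n choose i) - (real k / real n) ^ i))"
      by (simp add: bernstein_coeff_def poly_altdef right_diff_distrib sum_subtractf)
    also have "\<bar>\<dots>\<bar> \<le> (\<Sum>i\<le>degree p. \<bar>coeff p i * (real (k choose i) / real (n choose i) - (real k / real n) ^ i)\<bar>)"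
      by (rule sum_abs)
    also have "\<dots> \<le> (\<Sum>i\<le>degree p. \<bar>coeff p i\<bar> * (real i ^ 2 / real n))"
      unfolding abs_mult
      by (intro sum_mono mult_left_mono binomial_ratio_approx_power) (use n k in auto)
    also have "\<dots> = C / real n" by (simp add: C_def sum_divide_distrib)
    finally show ?thesis .
  qed
  moreover have "C \<ge> 0" by (auto simp: C_def intro: sum_nonneg)
  ultimately show ?thesis using that by blast
qed

section \<open>Bernstein coefficients of an increasing polynomial\<close>

lemma eventually_bernstein_coeff_nonneg_if_pos:
  assumes "\<And>u. u \<in> {0..1} \<Longrightarrow> poly p u > 0"
  shows "eventually (\<lambda>n. \<forall>k\<le>n. bernstein_coeff p n k \<ge> 0) sequentially"
proof -
  have "continuous_on {0..1} (poly p)" by (rule continuous_on_poly[OF continuous_on_id])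
  then obtain z where z: "z \<in> {0..1::real}" "\<And>u. u \<in> {0..1} \<Longrightarrow> poly p z \<le> poly p u"
    using continuous_attains_inf[of "{0..1::real}" "poly p"] by auto
  obtain C where C: "C \<ge> 0"
    "\<And>n k. degree p \<le> n \<Longrightarrow> n > 0 \<Longrightarrow> k \<le> n \<Longrightarrow>
       \<bar>bernstein_coeff p n k - poly p (real k / real n)\<bar> \<le> C / real n"
    using bernstein_coeff_approx_value[of p] by blast
  have "(\<lambda>n. C / real n) \<longlonglongrightarrow> 0" by (rule lim_const_over_n)
  then have "eventually (\<lambda>n. C / real n < poly p z) sequentially"
    using assms[OF z(1)] by (rule order_tendstoD(2))
  with eventually_ge_at_top[of "degree p"] eventually_gt_at_top[of "0::nat"]
  show ?thesis
  proof eventually_elim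
    case (elim n)
    show ?case
    proof (intro allI impI)
      fix k assume "k \<le> n"
      then have "poly p z \<le> poly p (real k / real n)" using elim by (intro z(2)) auto
      then show "bernstein_coeff p n k \<ge> 0" using C(2)[OF elim(1,2) \<open>k \<le> n\<close>] elim(3) by linarith
    qed
  qed
qed

lemma bernstein_coeff_monom_mult:
  "bernstein_coeff (monom 1 j * h) n k =
     real (k choose j) / real (n choose j) * bernstein_coeff h (n - j) (k - j)"
proof -
  have choose_add: "real (m choose (i + j)) = real (m choose j) * real ((m - j) choose i) / real ((i + j) choose j)"
    for m i
  proof (cases "i + j \<le> m")
    case True
    then have "real (m choose (i + j)) * real ((i + j) choose j) = real (m choose j) * real ((m - j) choose i)"
      using choose_mult[of j "i + j" m] unfolding of_nat_mult[symmetric] by simp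
    moreover have "real ((i + j) choose j) \<noteq> 0" by simp
    ultimately show ?thesis by (simp add: field_simps)
  qed (cases "j \<le> m"; auto simp: binomial_eq_0)
  have deg: "degree (monom 1 j * h) \<le> degree h + j"
    using degree_mult_le[of "monom 1 j" h] degree_monom_le[of "1::real" j] by linarith
  have "bernstein_coeff (monom 1 j * h) n k =
      (\<Sum>i\<le>degree h + j. coeff (monom 1 j * h) i * (real (k choose i) / real (n choose i)))"
    by (rule bernstein_coeff_eq_sum[OF deg])
  also have "\<dots> = (\<Sum>i\<in>{j..degree h + j}. coeff (monom 1 j * h) i * (real (k choose i) / real (n choose i)))"
    by (rule sum.mono_neutral_right) (auto simp: coeff_monom_mult)
  also have "\<dots> = (\<Sum>i\<le>degree h. coeff h i * (real (k choose (i + j)) / real (n choose (i + j))))"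
    by (rule sum.reindex_bij_witness[of _ "\<lambda>i. i + j" "\<lambda>i. i - j"]) (auto simp: coeff_monom_mult)
  also have "\<dots> = real (k choose j) / real (n choose j) * bernstein_coeff h (n - j) (k - j)"
    unfolding bernstein_coeff_def sum_distrib_left choose_add by (intro sum.cong) auto
  finally show ?thesis .
qed

text \<open>Positivity may fail at 0: a factor \<open>u\<^sup>j\<close> is split off, and it only multiplies the
  Bernstein coefficients of the positive cofactor by nonnegative numbers.\<close>
lemma eventually_bernstein_coeff_nonneg:
  assumes pos: "\<And>u. 0 < u \<Longrightarrow> u \<le> 1 \<Longrightarrow> poly p u > 0"
  shows "eventually (\<lambda>n. \<forall>k\<le>n. bernstein_coeff p n k \<ge> 0) sequentially"
proof -
  have "p \<noteq> 0" using pos[of 1] by auto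
  define j where "j = order 0 p"
  obtain h where h: "p = monom 1 j * h" "\<not> [:0, 1:] dvd h"
    using order_decomp[OF \<open>p \<noteq> 0\<close>, of 0] by (auto simp: j_def monom_altdef)
  have hpos: "poly h u > 0" if "0 < u" "u \<le> 1" for u
    using pos[OF that] that by (auto simp: h(1) poly_monom zero_less_mult_iff)
  have h0: "poly h 0 \<noteq> 0" using h(2) poly_eq_0_iff_dvd[of h 0] by simp
  have "(\<lambda>n. poly h (1 / real (Suc n))) \<longlonglongrightarrow> poly h 0"
    by (intro tendsto_poly LIMSEQ_Suc[OF lim_const_over_n])
  moreover have "poly h (1 / real (Suc n)) \<ge> 0" for n
    by (rule less_imp_le, rule hpos) auto
  ultimately have "poly h 0 \<ge> 0" by (intro LIMSEQ_le_const) auto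
  with h0 hpos have "poly h u > 0" if "u \<in> {0..1}" for u
    using that by (cases "u = 0") auto
  then have "eventually (\<lambda>n. \<forall>k\<le>n. bernstein_coeff h n k \<ge> 0) sequentially"
    by (rule eventually_bernstein_coeff_nonneg_if_pos)
  then obtain n0 where n0: "\<And>n k. n \<ge> n0 \<Longrightarrow> k \<le> n \<Longrightarrow> bernstein_coeff h n k \<ge> 0"
    by (auto simp: eventually_sequentially)
  show ?thesis
    unfolding eventually_sequentially
    by (intro exI[of _ "n0 + j"])
      (auto simp: h(1) bernstein_coeff_monom_mult intro!: divide_nonneg_nonneg mult_nonneg_nonneg n0)
qed

lemma eventually_bernstein_coeff_in_range:
  assumes "\<And>u. 0 < u \<Longrightarrow> u \<le> 1 \<Longrightarrow> poly p 0 < poly p u"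
    and "\<And>u. 0 \<le> u \<Longrightarrow> u < 1 \<Longrightarrow> poly p u < poly p 1"
  shows "eventually (\<lambda>n. \<forall>k\<le>n. bernstein_coeff p n k \<in> {poly p 0..poly p 1}) sequentially"
proof -
  have "eventually (\<lambda>n. \<forall>k\<le>n. bernstein_coeff (p - [:poly p 0:]) n k \<ge> 0) sequentially"
    using assms(1) by (intro eventually_bernstein_coeff_nonneg) simp
  moreover have "eventually (\<lambda>n. \<forall>k\<le>n. bernstein_coeff ([:poly p 1:] - pcompose p [:1, -1:]) n k \<ge> 0) sequentially"
    using assms(2) by (intro eventually_bernstein_coeff_nonneg) (simp add: poly_pcompose)
  ultimately show ?thesis
    using eventually_ge_at_top[of "degree p"]
  proof eventually_elim
    case (elim n)
    show ?case
    proof (intro allI impI)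
      fix k assume k: "k \<le> n"
      have "bernstein_coeff (pcompose p [:1, -1:]) n (n - k) = bernstein_coeff p n k"
        using bernstein_coeff_reflect[of p n "n - k"] elim(3) k by simp
      moreover have "bernstein_coeff ([:poly p 1:] - pcompose p [:1, -1:]) n (n - k) \<ge> 0"
        using elim(2) by auto
      ultimately show "bernstein_coeff p n k \<in> {poly p 0..poly p 1}"
        using elim(1)[rule_format, OF k] by (simp add: bernstein_coeff_diff)
    qed
  qed
qed

section \<open>Generalized Bernstein operators\<close>

lemma bernstein_basis_eq_Bernstein:
  assumes "a < b" "k \<le> n"
  shows "bernstein_basis a b n k x = Bernstein n k ((x - a) / (b - a))"
proof -
  have "1 - (x - a) / (b - a) = (b - x) / (b - a)" using assms by (simp add: field_simps)
  moreover have "(b - a) ^ n = (b - a) ^ k * (b - a) ^ (n - k)" using assms by (simp flip: power_add)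
  ultimately show ?thesis by (simp add: bernstein_basis_def Bernstein_def power_divide)
qed

text \<open>The nodes of an operator that fixes the constants and \<open>p\<close> are preimages of the Bernstein
  coefficients of \<open>p\<close>, transported to \<open>[0,1]\<close>, and its weights are all 1.\<close>
lemma is_bernstein_fixing_nodes:
  assumes ab: "a < b" and n: "degree p \<le> n" and T: "is_bernstein_fixing a b (poly p) n T"
  obtains t where "\<And>k. k \<le> n \<Longrightarrow> t k \<in> {a..b}"
    "\<And>k. k \<le> n \<Longrightarrow> poly p (t k) = bernstein_coeff (pcompose p [:a, b - a:]) n k"
    "\<And>f x. continuous_on {a..b} f \<Longrightarrow> x \<in> {a..b} \<Longrightarrow>
       T f x = (\<Sum>k\<le>n. f (t k) * bernstein_basis a b n k x)"
proof -
  let ?q = "pcompose p [:a, b - a:]"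
  obtain t \<alpha> where t: "\<And>k. k \<le> n \<Longrightarrow> t k \<in> {a..b}"
    and T_eq: "\<And>f x. continuous_on {a..b} f \<Longrightarrow> x \<in> {a..b} \<Longrightarrow>
      T f x = (\<Sum>k\<le>n. f (t k) * \<alpha> k * bernstein_basis a b n k x)"
    using T unfolding is_bernstein_fixing_def generalized_bernstein_op_def by blast
  \<comment> \<open>Comparison of Bernstein coefficients, used for the constant function and for \<open>p\<close>.\<close>
  have node: "f (t k) * \<alpha> k = bernstein_coeff q n k"
    if f: "continuous_on {a..b} f" "fixes_on a b T f" and q: "degree q \<le> n"
      "\<And>u. 0 < u \<Longrightarrow> u < 1 \<Longrightarrow> poly q u = f (a + u * (b - a))" and k: "k \<le> n" for f q k
  proof -
    have "(\<Sum>k\<le>n. (f (t k) * \<alpha> k - bernstein_coeff q n k) * Bernstein n k u) = 0"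
      if u: "0 < u" "u < 1" for u
    proof -
      define x where "x = a + u * (b - a)"
      have "a + u * (b - a) \<le> a + 1 * (b - a)"
        using u ab by (intro add_left_mono mult_right_mono) auto
      then have x: "x \<in> {a..b}" using u ab by (simp add: x_def)
      have xu: "(x - a) / (b - a) = u" using ab by (simp add: x_def)
      have "(\<Sum>k\<le>n. f (t k) * \<alpha> k * Bernstein n k u) = T f x"
        unfolding T_eq[OF f(1) x]
        by (rule sum.cong) (simp_all add: bernstein_basis_eq_Bernstein[OF ab] xu)
      also have "\<dots> = poly q u" using f(2) x q(2)[OF u] by (simp add: fixes_on_def x_def)
      also have "\<dots> = (\<Sum>k\<le>n. bernstein_coeff q n k * Bernstein n k u)"
        by (rule poly_eq_sum_bernstein_coeff[OF q(1)])
      finally show ?thesis by (simp add: left_diff_distrib sum_subtractf)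
    qed
    then have "f (t k) * \<alpha> k - bernstein_coeff q n k = 0"
      using Bernstein_linear_independent[where d = "\<lambda>k. f (t k) * \<alpha> k - bernstein_coeff q n k"] k
      by blast
    then show ?thesis by simp
  qed
  have \<alpha>: "\<alpha> k = 1" if "k \<le> n" for k
    using node[of "\<lambda>_. 1" "[:1:]" k] T that by (simp add: is_bernstein_fixing_def)
  have "continuous_on {a..b} (poly p)" by (rule continuous_on_poly[OF continuous_on_id])
  then have "poly p (t k) = bernstein_coeff ?q n k" if "k \<le> n" for k
    using node[of "poly p" ?q k] T that n \<alpha>
    by (simp add: is_bernstein_fixing_def degree_pcompose poly_pcompose)
  moreover have "T f x = (\<Sum>k\<le>n. f (t k) * bernstein_basis a b n k x)"
    if "continuous_on {a..b} f" "x \<in> {a..b}" for f x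
    unfolding T_eq[OF that] by (rule sum.cong) (simp_all add: \<alpha>)
  ultimately show ?thesis using t that by blast
qed

lemma is_bernstein_fixing_exists:
  assumes ab: "a < b" and n: "degree p \<le> n"
    and range: "\<And>k. k \<le> n \<Longrightarrow> bernstein_coeff (pcompose p [:a, b - a:]) n k \<in> {poly p a..poly p b}"
  shows "\<exists>T. is_bernstein_fixing a b (poly p) n T"
proof -
  let ?q = "pcompose p [:a, b - a:]"
  have cont: "continuous_on {a..b} (poly p)" by (rule continuous_on_poly[OF continuous_on_id])
  have "\<exists>t. t \<in> {a..b} \<and> poly p t = bernstein_coeff ?q n k" if "k \<le> n" for k
    using IVT'[of "poly p" a "bernstein_coeff ?q n k" b] cont range[OF that] ab by auto
  then obtain t where t: "\<And>k. k \<le> n \<Longrightarrow> t k \<in> {a..b}"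
    "\<And>k. k \<le> n \<Longrightarrow> poly p (t k) = bernstein_coeff ?q n k" by metis
  define T where "T f x = (\<Sum>k\<le>n. f (t k) * bernstein_basis a b n k x)" for f :: "real \<Rightarrow> real" and x
  have "generalized_bernstein_op a b n T"
    unfolding generalized_bernstein_op_def
    by (intro exI[of _ t] exI[of _ "\<lambda>_. 1"]) (use t in \<open>auto simp: T_def\<close>)
  moreover have "T (\<lambda>_. 1) x = 1" for x
    using sum_Bernstein[of n "(x - a) / (b - a)"]
    by (simp add: T_def bernstein_basis_eq_Bernstein[OF ab] del: sum_Bernstein)
  moreover have "T (poly p) x = poly p x" for x
  proof -
    have "T (poly p) x = (\<Sum>k\<le>n. bernstein_coeff ?q n k * Bernstein n k ((x - a) / (b - a)))"
      unfolding T_def by (rule sum.cong) (simp_all add: t bernstein_basis_eq_Bernstein[OF ab])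
    also have "\<dots> = poly ?q ((x - a) / (b - a))"
      by (rule poly_eq_sum_bernstein_coeff[symmetric]) (simp add: degree_pcompose n)
    also have "\<dots> = poly p x" using ab by (simp add: poly_pcompose)
    finally show ?thesis .
  qed
  ultimately show ?thesis unfolding is_bernstein_fixing_def fixes_on_def by blast
qed

lemma abs_diff_le_modulus_of_continuity:
  assumes "continuous_on {a..b} f" "x \<in> {a..b}" "y \<in> {a..b}" "\<bar>x - y\<bar> \<le> \<delta>"
  shows "\<bar>f x - f y\<bar> \<le> modulus_of_continuity a b f \<delta>"
proof -
  have "bounded (f ` {a..b})" using assms(1) by (intro compact_imp_bounded compact_continuous_image) auto
  then obtain B where B: "\<And>x. x \<in> {a..b} \<Longrightarrow> \<bar>f x\<bar> \<le> B"
    unfolding bounded_iff by (metis imageI real_norm_def)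
  have "bdd_above {\<bar>f x - f y\<bar> | x y. x \<in> {a..b} \<and> y \<in> {a..b} \<and> \<bar>x - y\<bar> \<le> \<delta>}"
  proof (rule bdd_aboveI[of _ "2 * B"])
    fix z assume "z \<in> {\<bar>f x - f y\<bar> | x y. x \<in> {a..b} \<and> y \<in> {a..b} \<and> \<bar>x - y\<bar> \<le> \<delta>}"
    then obtain x y where "z = \<bar>f x - f y\<bar>" "x \<in> {a..b}" "y \<in> {a..b}" by blast
    then show "z \<le> 2 * B" using B[of x] B[of y] by linarith
  qed
  then show ?thesis
    unfolding modulus_of_continuity_def by (rule cSup_upper[rotated]) (use assms in blast)
qed

lemma bernstein_sum_diff_le_modulus:
  assumes ab: "a < b" and f: "continuous_on {a..b} f" and x: "x \<in> {a..b}"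
    and t: "\<And>k. k \<le> n \<Longrightarrow> t k \<in> {a..b}" "\<And>k. k \<le> n \<Longrightarrow> r k \<in> {a..b}" "\<And>k. k \<le> n \<Longrightarrow> \<bar>t k - r k\<bar> \<le> \<delta>"
  shows "\<bar>(\<Sum>k\<le>n. f (t k) * bernstein_basis a b n k x) - (\<Sum>k\<le>n. f (r k) * bernstein_basis a b n k x)\<bar>
    \<le> modulus_of_continuity a b f \<delta>"
proof -
  define u where "u = (x - a) / (b - a)"
  have u: "0 \<le> u" "u \<le> 1" using x ab by (auto simp: u_def divide_le_eq_1)
  have "(\<Sum>k\<le>n. f (t k) * bernstein_basis a b n k x) - (\<Sum>k\<le>n. f (r k) * bernstein_basis a b n k x)
      = (\<Sum>k\<le>n. (f (t k) - f (r k)) * Bernstein n k u)"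
    unfolding sum_subtractf[symmetric]
    by (rule sum.cong) (simp_all add: u_def bernstein_basis_eq_Bernstein[OF ab] left_diff_distrib)
  also have "\<bar>\<dots>\<bar> \<le> (\<Sum>k\<le>n. \<bar>(f (t k) - f (r k)) * Bernstein n k u\<bar>)" by (rule sum_abs)
  also have "\<dots> \<le> (\<Sum>k\<le>n. modulus_of_continuity a b f \<delta> * Bernstein n k u)"
    using u by (intro sum_mono)
      (auto simp: abs_mult Bernstein_nonneg intro!: mult_right_mono abs_diff_le_modulus_of_continuity f t)
  also have "\<dots> = modulus_of_continuity a b f \<delta>" by (simp flip: sum_distrib_left)
  finally show ?thesis .
qed

section \<open>Distance to the classical operator\<close>

lemma order_less_Suc_max_zero_order:
  assumes "q \<noteq> 0" "z \<in> {a..b}"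
  shows "order z q < max_zero_order a b q + 1"
proof (cases "poly q z = 0")
  case True
  have "finite {z \<in> {a..b}. poly q z = 0}"
    by (rule finite_subset[OF _ poly_roots_finite[OF assms(1)]]) auto
  then have "order z q \<le> max_zero_order a b q"
    unfolding max_zero_order_def using True assms(2) by (intro Max_ge) auto
  then show ?thesis by simp
qed (simp add: order_0I)

theorem theorem6p10:
  fixes a b :: real and f1 :: "real poly" and s :: nat
  assumes "a < b"
    and "degree f1 \<ge> 1"
    and "mono_on {a..b} (poly f1)"
    and "s = max_zero_order a b (pderiv f1) + 1"
  shows "\<exists>K n0. K > 0 \<and>
    (\<forall>n\<ge>n0.
      (\<exists>T. is_bernstein_fixing a b (poly f1) n T) \<and>
      (\<forall>T f x. is_bernstein_fixing a b (poly f1) n T \<longrightarrow> continuous_on {a..b} f \<longrightarrow> x \<in> {a..b} \<longrightarrow>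
         \<bar>T f x - bernstein_op a b n f x\<bar>
           \<le> modulus_of_continuity a b f (K * real n powr (- 1 / real s))))"
proof -
  have nz: "pderiv f1 \<noteq> 0" using assms(2) by (simp add: pderiv_eq_0_iff)
  have s: "s \<ge> 1" using assms(4) by simp
  obtain c where c: "c > 0"
    and growth: "\<And>x y. a \<le> x \<Longrightarrow> x \<le> y \<Longrightarrow> y \<le> b \<Longrightarrow> c * (y - x) ^ s \<le> poly f1 y - poly f1 x"
    using mono_poly_increment_lower_bound[OF assms(1,3) nz, of s]
      order_less_Suc_max_zero_order[OF nz] assms(4) by metis
  have strict: "poly f1 x < poly f1 y" if "a \<le> x" "x < y" "y \<le> b" for x y
  proof -
    have "0 < c * (y - x) ^ s" using c that by simp
    then show ?thesis using growth[of x y] that by linarith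
  qed
  define g where "g = pcompose f1 [:a, b - a:]"
  have poly_g: "poly g u = poly f1 (a + u * (b - a))" for u by (simp add: g_def poly_pcompose)
  have deg_g: "degree g = degree f1" using assms(1) by (simp add: g_def degree_pcompose)
  have interval: "a + u * (b - a) \<le> b" if "u \<le> 1" for u
  proof -
    have "a + u * (b - a) \<le> a + 1 * (b - a)"
      using that assms(1) by (intro add_left_mono mult_right_mono) auto
    then show ?thesis by simp
  qed
  have "eventually (\<lambda>n. \<forall>k\<le>n. bernstein_coeff g n k \<in> {poly g 0..poly g 1}) sequentially"
  proof (rule eventually_bernstein_coeff_in_range)
    fix u :: real assume "0 < u" "u \<le> 1"
    then show "poly g 0 < poly g u" using assms(1) interval[of u] by (auto simp: poly_g intro!: strict)
  next
    fix u :: real assume u: "0 \<le> u" "u < 1"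
    have "a + u * (b - a) < a + 1 * (b - a)"
      using u assms(1) by (intro add_strict_left_mono mult_strict_right_mono) auto
    then have "a + u * (b - a) < b" by simp
    then show "poly g u < poly g 1" using u assms(1) by (auto simp: poly_g intro!: strict)
  qed
  then obtain n1 where n1:
    "\<And>n k. n \<ge> n1 \<Longrightarrow> k \<le> n \<Longrightarrow> bernstein_coeff g n k \<in> {poly g 0..poly g 1}"
    by (auto simp: eventually_sequentially)
  obtain C where C: "C \<ge> 0"
    "\<And>n k. degree g \<le> n \<Longrightarrow> n > 0 \<Longrightarrow> k \<le> n \<Longrightarrow>
       \<bar>bernstein_coeff g n k - poly g (real k / real n)\<bar> \<le> C / real n"
    using bernstein_coeff_approx_value[of g] by blast
  \<comment> \<open>\<open>C\<close> may be 0, and \<open>C + 1\<close> makes \<open>K\<close> positive.\<close>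
  define K where "K = ((C + 1) / c) powr (1 / real s)"
  define n0 where "n0 = max n1 (degree f1)"
  have "K > 0" using c C(1) by (simp add: K_def)
  moreover have "\<exists>T. is_bernstein_fixing a b (poly f1) n T" if "n \<ge> n0" for n
    using that assms(1) n1[of n]
    by (intro is_bernstein_fixing_exists) (auto simp: n0_def g_def[symmetric] poly_g)
  moreover have "\<bar>T f x - bernstein_op a b n f x\<bar>
      \<le> modulus_of_continuity a b f (K * real n powr (- 1 / real s))"
    if n: "n \<ge> n0" and T: "is_bernstein_fixing a b (poly f1) n T"
      and f: "continuous_on {a..b} f" and x: "x \<in> {a..b}" for n T f x
  proof -
    have deg: "degree f1 \<le> n" and npos: "n > 0" using n assms(2) by (auto simp: n0_def)
    obtain t where t: "\<And>k. k \<le> n \<Longrightarrow> t k \<in> {a..b}"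
      "\<And>k. k \<le> n \<Longrightarrow> poly f1 (t k) = bernstein_coeff g n k"
      and T_eq: "T f x = (\<Sum>k\<le>n. f (t k) * bernstein_basis a b n k x)"
      using is_bernstein_fixing_nodes[OF assms(1) deg T] f x unfolding g_def by metis
    define r where "r k = a + real k / real n * (b - a)" for k
    have r: "r k \<in> {a..b}" if "k \<le> n" for k
      using that npos assms(1) interval[of "real k / real n"] by (auto simp: r_def)
    have "\<bar>t k - r k\<bar> \<le> K * real n powr (- 1 / real s)" if k: "k \<le> n" for k
    proof -
      let ?d = "\<bar>t k - r k\<bar>"
      have "c * ?d ^ s \<le> \<bar>poly f1 (t k) - poly f1 (r k)\<bar>"
        using growth[of "t k" "r k"] growth[of "r k" "t k"] t(1)[OF k] r[OF k]
        by (cases "t k \<le> r k") auto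
      also have "\<dots> \<le> C / real n"
        using C(2)[of n k] deg deg_g npos k t(2)[OF k] by (simp add: poly_g r_def)
      also have "\<dots> \<le> (C + 1) / real n" by (intro divide_right_mono) auto
      finally have "?d ^ s \<le> (C + 1) / real n / c"
        using c by (simp only: pos_le_divide_eq mult.commute)
      then have "(?d ^ s) powr (1 / real s) \<le> ((C + 1) / real n / c) powr (1 / real s)"
        by (intro powr_mono2) auto
      also have "\<dots> = K / real n powr (1 / real s)"
      proof -
        have "(C + 1) / real n / c = (C + 1) / c / real n" by simp
        then show ?thesis using C(1) c by (simp only: K_def powr_divide)
      qed
      also have "\<dots> = K * real n powr (- 1 / real s)"
        by (simp add: powr_minus_divide)
      also have "(?d ^ s) powr (1 / real s) = ?d"
        using s by (cases "?d = 0") (auto simp: powr_powr simp flip: powr_realpow)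
      finally show ?thesis .
    qed
    from bernstein_sum_diff_le_modulus[where t = t and r = r, OF assms(1) f x t(1) r this]
    show ?thesis unfolding T_eq bernstein_op_def r_def .
  qed
  ultimately show ?thesis by blast
qed

end
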